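(* Let $(X,d)$ be a metric space and let $F:X\to 2^X$ be a set-valued map with the periodic shadowing property. Then $F^n$ has the periodic shadowing property for every integer $n\ge 1$.
   Context: Here $\mathbb N=\{0,1,2,\dots\}$ and $2^X$ is the family of nonempty compact subsets of $X$. For $x\in X$ and $A\subset X$, $d(x,A)=\inf\{d(x,y): y\in A\}$. The iterates are defined by $F^1=F$ and $F^{n+1}(x)=\bigcup_{y\in F^n(x)}F(y)$; i.e. $F^n(x)$ is the set of all $x_n$ for which there are $x_0=x,x_1,\dots,x_n$ with $x_{i+1}\in F(x_i)$ for $0\le i\le n-1$. The following notions are used for any map $G$ assigning to each point of $X$ a nonempty subset of $X$ (in particular $G=F$ and $G=F^n$). An orbit of $G$ is a sequence $\{x_i\}_{i\in\mathbb N}$ with $x_{i+1}\in G(x_i)$ for all $i$. A $\delta$-pseudo-orbit of $G$ is a sequence $\{x_i\}_{i\in\mathbb N}$ with $d(x_{i+1},G(x_i))<\delta$ for all $i$. A sequence $\{x_i\}_{i\in\mathbb N}$ is periodic if there is an integer $m\ge 1$ with $x_{i+m}=x_i$ for all $i\in\mathbb N$. $G$ has the periodic shadowing property if for every $\varepsilon>0$ there is $\delta>0$ such that for every periodic $\delta$-pseudo-orbit $\{x_i\}_{i\in\mathbb N}$ of $G$ there is a periodic orbit $\{z_i\}_{i\in\mathbb N}$ of $G$ (not required to have the same period) with $d(z_i,x_i)<\varepsilon$ for all $i\in\mathbb N$. *)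

theory Defs
  imports "HOL-Analysis.Analysis"
begin

(* A set-valued map on the metric space is a function 'a => 'a set; the metric space is the
   whole type 'a.  Nonemptiness (and compactness) of the values is a hypothesis of the
   theorem, not part of the type.  For nonempty A, infdist x A is the infimum of dist x y
   over y in A; the library sets infdist x {} = 0. *)

text \<open>The value at 0 is the singleton of the point, so that the iterate at 1 is \<open>F\<close>.\<close>
primrec set_iter :: "nat \<Rightarrow> ('a \<Rightarrow> 'a set) \<Rightarrow> 'a \<Rightarrow> 'a set" where
  "set_iter 0 F x = {x}"
| "set_iter (Suc n) F x = (\<Union>y\<in>set_iter n F x. F y)"

lemma set_iter_1: "set_iter 1 F = F"
  by (rule ext) simp

lemma mem_set_iter_iff:
  "y \<in> set_iter n F x \<longleftrightarrow> (\<exists>u. u 0 = x \<and> u n = y \<and> (\<forall>i<n. u (Suc i) \<in> F (u i)))"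
proof (induction n arbitrary: y)
  case 0
  show ?case by auto
next
  case (Suc n)
  show ?case
  proof
    assume "y \<in> set_iter (Suc n) F x"
    then obtain w where w: "w \<in> set_iter n F x" "y \<in> F w" by auto
    then obtain u where u: "u 0 = x" "u n = w" "\<forall>i<n. u (Suc i) \<in> F (u i)"
      using Suc.IH by blast
    show "\<exists>u. u 0 = x \<and> u (Suc n) = y \<and> (\<forall>i<Suc n. u (Suc i) \<in> F (u i))"
      by (rule exI[of _ "u(Suc n := y)"]) (use u w in \<open>auto simp: less_Suc_eq\<close>)
  next
    assume "\<exists>u. u 0 = x \<and> u (Suc n) = y \<and> (\<forall>i<Suc n. u (Suc i) \<in> F (u i))"
    then obtain u where u: "u 0 = x" "u (Suc n) = y" "\<forall>i<Suc n. u (Suc i) \<in> F (u i)"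
      by blast
    then have "u n \<in> set_iter n F x" using Suc.IH by auto
    then show "y \<in> set_iter (Suc n) F x" using u by auto
  qed
qed

definition is_orbit :: "('a \<Rightarrow> 'a set) \<Rightarrow> (nat \<Rightarrow> 'a) \<Rightarrow> bool" where
  "is_orbit G x \<longleftrightarrow> (\<forall>i. x (Suc i) \<in> G (x i))"

definition pseudo_orbit :: "real \<Rightarrow> ('a::metric_space \<Rightarrow> 'a set) \<Rightarrow> (nat \<Rightarrow> 'a) \<Rightarrow> bool" where
  "pseudo_orbit \<delta> G x \<longleftrightarrow> (\<forall>i. infdist (x (Suc i)) (G (x i)) < \<delta>)"

definition periodic_seq :: "(nat \<Rightarrow> 'a) \<Rightarrow> bool" where
  "periodic_seq x \<longleftrightarrow> (\<exists>m\<ge>1. \<forall>i. x (i + m) = x i)"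

definition periodic_shadowing :: "('a::metric_space \<Rightarrow> 'a set) \<Rightarrow> bool" where
  "periodic_shadowing G \<longleftrightarrow>
     (\<forall>\<epsilon>>0. \<exists>\<delta>>0. \<forall>x. pseudo_orbit \<delta> G x \<and> periodic_seq x \<longrightarrow>
        (\<exists>z. is_orbit G z \<and> periodic_seq z \<and> (\<forall>i. dist (z i) (x i) < \<epsilon>)))"

end

theory Submission
  imports Defs
begin

text \<open>Replace every jump of a periodic pseudo-orbit of \<open>F\<^sup>n\<close> by a genuine \<open>F\<close>-path of
  length \<open>n\<close> ending close to the next point. Choosing the paths periodically gives a periodic
  pseudo-orbit of \<open>F\<close> with the same error; every \<open>n\<close>-th point of a periodic orbit of \<open>F\<close>
  shadowing it forms a periodic orbit of \<open>F\<^sup>n\<close>.\<close>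

lemma set_iter_nonempty:
  assumes "\<And>x. F x \<noteq> {}"
  shows "set_iter n F x \<noteq> {}"
  using assms by (induction n) auto

text \<open>Because the inequality is strict, some member of \<open>A\<close> already beats the
  bound. Nonemptiness excludes the default \<open>infdist x {} = 0\<close>.\<close>

lemma infdist_less_obtain:
  assumes "A \<noteq> {}" "infdist x A < \<delta>"
  obtains y where "y \<in> A" "dist x y < \<delta>"
proof -
  have "bdd_below (dist x ` A)"
    by (rule bdd_belowI2[of _ 0]) simp
  then show thesis
    using assms that by (auto simp: infdist_notempty cINF_less_iff)
qed

lemma periodic_add_mult:
  fixes z :: "nat \<Rightarrow> 'a"
  assumes "\<And>i. z (i + p) = z i"
  shows "z (i + k * p) = z i"
proof (induction k)
  case (Suc k)
  have "z (i + Suc k * p) = z ((i + k * p) + p)"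
    by (simp add: algebra_simps)
  then show ?case
    using assms Suc by simp
qed simp

text \<open>A period \<open>p\<close> of \<open>z\<close> is again a period of the subsample:
  shifting its index by \<open>p\<close> shifts that of \<open>z\<close> by \<open>p * n\<close>, a
  multiple of \<open>p\<close>.\<close>

lemma periodic_seq_subsample:
  assumes "periodic_seq z"
  shows "periodic_seq (\<lambda>i. z (i * n))"
proof -
  obtain p where p: "p \<ge> 1" "\<And>i. z (i + p) = z i"
    using assms by (auto simp: periodic_seq_def)
  have "z ((i + p) * n) = z (i * n)" for i
    using periodic_add_mult[of z p "i * n" n, OF p(2)]
    by (simp add: algebra_simps)
  then show ?thesis
    using p(1) by (auto simp: periodic_seq_def)
qed

lemma is_orbit_subsample:
  assumes "is_orbit F z"
  shows "is_orbit (set_iter n F) (\<lambda>i. z (i * n))"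
  unfolding is_orbit_def
proof
  fix i
  show "z (Suc i * n) \<in> set_iter n F (z (i * n))"
    unfolding mem_set_iter_iff
    using assms by (intro exI[of _ "\<lambda>j. z (i * n + j)"]) (simp add: is_orbit_def add.commute)
qed

lemma periodic_pseudo_orbit_refine:
  assumes ne: "\<And>x. F x \<noteq> {}" and "n \<ge> 1"
    and "pseudo_orbit \<delta> (set_iter n F) x" "periodic_seq x"
  obtains w where "pseudo_orbit \<delta> F w" "periodic_seq w" "\<And>i. w (i * n) = x i"
proof -
  have "\<exists>u. u 0 = x i \<and> (\<forall>j<n. u (Suc j) \<in> F (u j)) \<and> dist (x (Suc i)) (u n) < \<delta>" for i
  proof -
    have "infdist (x (Suc i)) (set_iter n F (x i)) < \<delta>"
      using assms(3) by (simp add: pseudo_orbit_def)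
    with set_iter_nonempty[OF ne]
    obtain y where "y \<in> set_iter n F (x i)" "dist (x (Suc i)) y < \<delta>"
      by (rule infdist_less_obtain)
    then show ?thesis
      unfolding mem_set_iter_iff by blast
  qed
  then obtain U where U0: "\<And>i. U i 0 = x i"
    and UF: "\<And>i j. j < n \<Longrightarrow> U i (Suc j) \<in> F (U i j)"
    and Un: "\<And>i. dist (x (Suc i)) (U i n) < \<delta>"
    by metis
  \<comment> \<open>Positivity is read off from a distance below \<open>\<delta>\<close>; it settles
    the exact steps of \<open>w\<close>, where \<open>infdist\<close> is 0.\<close>
  have "0 < \<delta>"
    using Un[of 0] le_less_trans[OF zero_le_dist] by blast
  obtain m where m: "m \<ge> 1" "\<And>i. x (i + m) = x i"
    using assms(4) by (auto simp: periodic_seq_def)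
  have xmod: "x (i mod m) = x i" for i
    using periodic_add_mult[of x m "i mod m" "i div m", OF m(2)] by simp
  \<comment> \<open>This covers the wrap-around, where \<open>Suc (i mod m)\<close> equals
    \<open>m\<close>.\<close>
  have xSuc: "x (Suc (i mod m)) = x (Suc i)" for i
    by (metis xmod mod_Suc_eq)
  \<comment> \<open>The chosen paths \<open>U i\<close> need not repeat when \<open>x\<close> does.
    Reducing the block number modulo \<open>m\<close> reuses the first \<open>m\<close> paths and so
    forces the period \<open>m * n\<close>.\<close>
  define w where "w k = U (k div n mod m) (k mod n)" for k
  have "infdist (w (Suc k)) (F (w k)) < \<delta>" for k
  proof (cases "Suc (k mod n) = n")
    case True
    then have "w (Suc k) = x (Suc (k div n) mod m)"
      by (simp add: w_def U0 xmod div_Suc mod_Suc[of k n])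
    then have "w (Suc k) = x (Suc (k div n mod m))"
      by (simp only: xmod xSuc)
    \<comment> \<open>Since \<open>k mod n < n\<close>, \<open>w\<close> leaves out the endpoint of
      each path and puts the start of the next path in its place. The omitted endpoint is the point
      of \<open>F (w k)\<close> within \<open>\<delta>\<close> of \<open>w (Suc k)\<close>.\<close>
    moreover have "U (k div n mod m) n \<in> F (w k)"
      using UF[of "k mod n" "k div n mod m"] True by (simp add: w_def)
    ultimately show ?thesis
      using le_less_trans[OF infdist_le Un[of "k div n mod m"]] by simp
  next
    case False
    then have "w (Suc k) = U (k div n mod m) (Suc (k mod n))"
      by (simp add: w_def div_Suc mod_Suc)
    then have "w (Suc k) \<in> F (w k)"
      using UF[of "k mod n"] \<open>n \<ge> 1\<close> by (simp add: w_def)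
    then show ?thesis
      using \<open>0 < \<delta>\<close> by simp
  qed
  then have "pseudo_orbit \<delta> F w"
    by (simp add: pseudo_orbit_def)
  moreover have "w (k + m * n) = w k" for k
    using \<open>n \<ge> 1\<close> by (simp add: w_def)
  then have "periodic_seq w"
    unfolding periodic_seq_def using m(1) \<open>n \<ge> 1\<close> by (intro exI[of _ "m * n"]) simp
  moreover have "w (i * n) = x i" for i
    using \<open>n \<ge> 1\<close> by (simp add: w_def U0 xmod)
  ultimately show thesis
    by (rule that)
qed

theorem proposition5p5:
  fixes F :: "'a::metric_space \<Rightarrow> 'a set" and n :: nat
  assumes "\<And>x. F x \<noteq> {} \<and> compact (F x)"
    and "periodic_shadowing F"
    and "n \<ge> 1"
  shows "periodic_shadowing (set_iter n F)"
  unfolding periodic_shadowing_def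
proof (intro allI impI)
  fix \<epsilon> :: real
  assume "\<epsilon> > 0"
  then obtain \<delta> where "\<delta> > 0" and shadow:
    "\<And>x. pseudo_orbit \<delta> F x \<Longrightarrow> periodic_seq x \<Longrightarrow>
      \<exists>z. is_orbit F z \<and> periodic_seq z \<and> (\<forall>i. dist (z i) (x i) < \<epsilon>)"
    using assms(2) unfolding periodic_shadowing_def by metis
  have "\<exists>z. is_orbit (set_iter n F) z \<and> periodic_seq z \<and> (\<forall>i. dist (z i) (x i) < \<epsilon>)"
    if x: "pseudo_orbit \<delta> (set_iter n F) x" "periodic_seq x" for x
  proof -
    have ne: "F y \<noteq> {}" for y
      using assms(1) by simp
    \<comment> \<open>Refinement does not enlarge the error, so the \<open>\<delta>\<close> found
      for \<open>F\<close> serves unchanged for \<open>set_iter n F\<close>.\<close>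
    obtain w where w_orbit: "pseudo_orbit \<delta> F w" "periodic_seq w"
      and w: "\<And>i. w (i * n) = x i"
      using periodic_pseudo_orbit_refine[of F, OF ne assms(3) x] by blast
    from shadow[OF w_orbit] obtain z
      where "is_orbit F z" "periodic_seq z" "\<And>i. dist (z i) (w i) < \<epsilon>"
      by blast
    then show ?thesis
      by (intro exI[of _ "\<lambda>i. z (i * n)"])
        (simp add: is_orbit_subsample periodic_seq_subsample flip: w)
  qed
  with \<open>\<delta> > 0\<close> show "\<exists>\<delta>>0. \<forall>x. pseudo_orbit \<delta> (set_iter n F) x \<and> periodic_seq x \<longrightarrow>
      (\<exists>z. is_orbit (set_iter n F) z \<and> periodic_seq z \<and> (\<forall>i. dist (z i) (x i) < \<epsilon>))"
    by blast
qed

end
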